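(* For every $e\in\omega$ there is a string $\rho$ such that for all but finitely many strings $\tau$, $K(\tau\mid \rho)<K(\tau)-e$.
   Context: $K$ is prefix-free Kolmogorov complexity and $K(\tau\mid\rho)$ is the conditional prefix-free complexity of $\tau$ given the string $\rho$. *)

theory Defs
  imports "HOL-Library.Sublist" "HOL-Library.Infinite_Set"
begin

text \<open>
  Partial recursive functions on the natural numbers, as programs with a big-step semantics.
  Programs carry no arity: a program has a value on an argument list only if one of the rules
  applies to a list of that length, so for each \<open>k\<close> it denotes a partial recursive function of
  \<open>k\<close> arguments.
\<close>

datatype recf =
    Zero
  | Succ
  | Proj nat
  | Comp recf "recf list"
  | PrimRec recf recf
  | Mu recf

inductive computes :: "recf \<Rightarrow> nat list \<Rightarrow> nat \<Rightarrow> bool" where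
  zero: "computes Zero xs 0"
| succ: "computes Succ [x] (Suc x)"
| proj: "i < length xs \<Longrightarrow> computes (Proj i) xs (xs ! i)"
| comp: "\<lbrakk>list_all2 (\<lambda>g y. computes g xs y) gs ys; computes f ys z\<rbrakk>
    \<Longrightarrow> computes (Comp f gs) xs z"
| primrec_0: "computes f xs y \<Longrightarrow> computes (PrimRec f g) (0 # xs) y"
| primrec_Suc: "\<lbrakk>computes (PrimRec f g) (n # xs) y; computes g (n # y # xs) z\<rbrakk>
    \<Longrightarrow> computes (PrimRec f g) (Suc n # xs) z"
| mu: "\<lbrakk>computes f (n # xs) 0; \<forall>m<n. \<exists>y>0. computes f (m # xs) y\<rbrakk>
    \<Longrightarrow> computes (Mu f) xs n"

text \<open>
  Binary strings are identified with natural numbers via their position in the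
  length-lexicographic order: \<open>str_code \<sigma> + 1\<close> is the number with binary notation \<open>1\<sigma>\<close>.
\<close>

type_synonym str = "bool list"

definition str_code :: "str \<Rightarrow> nat" where
  "str_code \<sigma> = foldl (\<lambda>n b. 2 * n + (if b then 2 else 1)) 0 \<sigma>"

definition partial_computable :: "(str \<Rightarrow> str option) \<Rightarrow> bool" where
  "partial_computable M \<longleftrightarrow>
     (\<exists>p. \<forall>\<sigma> y. computes p [str_code \<sigma>] y \<longleftrightarrow> (\<exists>\<tau>. M \<sigma> = Some \<tau> \<and> y = str_code \<tau>))"

definition partial_computable2 :: "(str \<Rightarrow> str \<Rightarrow> str option) \<Rightarrow> bool" where
  "partial_computable2 M \<longleftrightarrow>
     (\<exists>p. \<forall>\<rho> \<sigma> y. computes p [str_code \<rho>, str_code \<sigma>] y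
        \<longleftrightarrow> (\<exists>\<tau>. M \<rho> \<sigma> = Some \<tau> \<and> y = str_code \<tau>))"

definition prefix_free :: "str set \<Rightarrow> bool" where
  "prefix_free A \<longleftrightarrow> (\<forall>\<sigma>\<in>A. \<forall>\<tau>\<in>A. prefix \<sigma> \<tau> \<longrightarrow> \<sigma> = \<tau>)"

definition pf_machine :: "(str \<Rightarrow> str option) \<Rightarrow> bool" where
  "pf_machine M \<longleftrightarrow> partial_computable M \<and> prefix_free (dom M)"

text \<open>The first argument of a conditional machine is the condition, the second the program.\<close>

definition cond_pf_machine :: "(str \<Rightarrow> str \<Rightarrow> str option) \<Rightarrow> bool" where
  "cond_pf_machine M \<longleftrightarrow> partial_computable2 M \<and> (\<forall>\<rho>. prefix_free (dom (M \<rho>)))"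

text \<open>
  Universality is meant in the sense of additive optimality. Machines that are universal by
  adjunction, \<open>U (\<sigma>\<^sub>M @ \<sigma>) = M \<sigma>\<close> for a string \<open>\<sigma>\<^sub>M\<close> depending only on \<open>M\<close>, are universal in this
  sense. In the conditional case the constant must not depend on the condition.
\<close>

definition universal_pf_machine :: "(str \<Rightarrow> str option) \<Rightarrow> bool" where
  "universal_pf_machine U \<longleftrightarrow> pf_machine U \<and>
     (\<forall>M. pf_machine M \<longrightarrow>
        (\<exists>d. \<forall>\<sigma> \<tau>. M \<sigma> = Some \<tau> \<longrightarrow>
           (\<exists>\<sigma>'. U \<sigma>' = Some \<tau> \<and> length \<sigma>' \<le> length \<sigma> + d)))"

definition universal_cond_pf_machine :: "(str \<Rightarrow> str \<Rightarrow> str option) \<Rightarrow> bool" where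
  "universal_cond_pf_machine V \<longleftrightarrow> cond_pf_machine V \<and>
     (\<forall>M. cond_pf_machine M \<longrightarrow>
        (\<exists>d. \<forall>\<rho> \<sigma> \<tau>. M \<rho> \<sigma> = Some \<tau> \<longrightarrow>
           (\<exists>\<sigma>'. V \<rho> \<sigma>' = Some \<tau> \<and> length \<sigma>' \<le> length \<sigma> + d)))"

text \<open>
  The minimum is over a nonempty set when the machine is universal, since every string is
  then in the range of the machine (for each condition).
\<close>

definition K :: "(str \<Rightarrow> str option) \<Rightarrow> str \<Rightarrow> nat" where
  "K U \<tau> = (LEAST n. \<exists>\<sigma>. U \<sigma> = Some \<tau> \<and> length \<sigma> = n)"

definition cond_K :: "(str \<Rightarrow> str \<Rightarrow> str option) \<Rightarrow> str \<Rightarrow> str \<Rightarrow> nat" where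
  "cond_K V \<tau> \<rho> = K (V \<rho>) \<tau>"

end

(* Let U be computed by p and enumerate the halting computations of p, each U-program \<sigma> appearing
   exactly once. By Kraft's inequality the weights 2^-|\<sigma>| are summable, so for every c there is
   an N such that the computations from index N on have total weight less than 2^-c. Given
   \<rho> = (c, N), lay the intervals of length 2^-|\<sigma>| of the later computations side by side, starting
   at 0; each contains a dyadic interval of length 2^-(|\<sigma>| + 1), whose binary notation starts with
   c zeros since everything happens below 2^-c. Dropping these zeros gives a prefix-free code with
   words of length |\<sigma>| + 1 - c, decoded by a single conditional machine for all \<rho>. The constant d of
   that machine does not depend on c, and c = d + e + 2 suffices. *)
theory Submission
  imports Defs Complex_Main "HOL-Library.Nat_Bijection"
begin

\<comment> \<open>Total computable functions and their closure properties\<close>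
inductive_simps computes_Zero: "computes Zero xs y"
inductive_simps computes_Succ: "computes Succ xs y"
inductive_simps computes_Proj: "computes (Proj i) xs y"
inductive_simps computes_Comp: "computes (Comp f gs) xs z"
inductive_simps computes_PrimRec_0: "computes (PrimRec f g) (0 # xs) z"
inductive_simps computes_PrimRec_Suc: "computes (PrimRec f g) (Suc n # xs) z"
inductive_simps computes_Mu: "computes (Mu f) xs z"

text \<open>Only total functions are covered, so composition and recursion raise no questions of
  definedness. Partial functions are built only at the end, by one unbounded search
  (\<open>computable_search\<close>). Values of \<open>f\<close> at lists of other lengths do not
  matter, which \<open>computable_cong\<close> exploits.\<close>

definition computable :: "nat \<Rightarrow> (nat list \<Rightarrow> nat) \<Rightarrow> bool" where
  "computable k f \<longleftrightarrow> (\<exists>p. \<forall>xs y. length xs = k \<longrightarrow> (computes p xs y \<longleftrightarrow> y = f xs))"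

lemma computable_cong:
  assumes "computable k f" "\<And>xs. length xs = k \<Longrightarrow> f xs = g xs"
  shows "computable k g"
  using assms unfolding computable_def by metis

lemma computable_compose:
  assumes "computable (length gs) f" "\<forall>g\<in>set gs. computable k g"
  shows "computable k (\<lambda>xs. f (map (\<lambda>g. g xs) gs))"
proof -
  obtain p where p: "\<And>xs y. length xs = length gs \<Longrightarrow> computes p xs y \<longleftrightarrow> y = f xs"
    using assms(1) unfolding computable_def by blast
  obtain q where q: "\<And>g xs y. g \<in> set gs \<Longrightarrow> length xs = k \<Longrightarrow> computes (q g) xs y \<longleftrightarrow> y = g xs"
    using assms(2) unfolding computable_def by metis
  have "computes (Comp p (map q gs)) xs y \<longleftrightarrow> y = f (map (\<lambda>g. g xs) gs)" if "length xs = k" for xs y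
  proof -
    have "list_all2 (\<lambda>g y. computes g xs y) (map q gs) ys \<longleftrightarrow> ys = map (\<lambda>g. g xs) gs" for ys
      using q[OF nth_mem that] by (auto simp: list_all2_conv_all_nth list_eq_iff_nth_eq)
    then show ?thesis using p by (auto simp: computes_Comp)
  qed
  then show ?thesis unfolding computable_def by blast
qed

lemma computable_nth: "i < k \<Longrightarrow> computable k (\<lambda>xs. xs ! i)"
  unfolding computable_def by (intro exI[of _ "Proj i"]) (auto simp: computes_Proj)

lemma computable_Suc_hd: "computable 1 (\<lambda>xs. Suc (hd xs))"
  unfolding computable_def
  by (intro exI[of _ Succ]) (auto simp: computes_Succ length_Suc_conv)

lemma computable1:
  assumes "computable 1 (\<lambda>xs. f (hd xs))" "computable k g"
  shows "computable k (\<lambda>xs. f (g xs))"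
  using computable_compose[of "[g]" "\<lambda>xs. f (hd xs)" k] assms by simp

lemma computable_Suc: "computable k g \<Longrightarrow> computable k (\<lambda>xs. Suc (g xs))"
  using computable1[OF computable_Suc_hd] .

lemma computable_const: "computable k (\<lambda>xs. n)"
proof (induction n)
  case 0
  show ?case unfolding computable_def by (intro exI[of _ Zero]) (auto simp: computes_Zero)
qed (use computable_Suc in auto)

text \<open>The functions in \<open>fs\<close> may permute, modify or duplicate arguments; the arguments from
  position \<open>j\<close> on are passed through.\<close>

lemma computable_args:
  assumes "computable (length fs + (k - j)) f" "\<forall>h\<in>set fs. computable k h" "j \<le> k"
  shows "computable k (\<lambda>xs. f (map (\<lambda>h. h xs) fs @ drop j xs))"
proof -
  let ?gs = "fs @ map (\<lambda>i xs. xs ! i) [j..<k]"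
  have "computable k (\<lambda>xs. f (map (\<lambda>g. g xs) ?gs))"
    using assms by (intro computable_compose) (auto intro: computable_nth)
  moreover have "map (\<lambda>g. g xs) ?gs = map (\<lambda>h. h xs) fs @ drop j xs" if "length xs = k" for xs
    using that by (auto intro!: nth_equalityI)
  ultimately show ?thesis by (elim computable_cong) simp
qed

lemma computable_hd: "0 < k \<Longrightarrow> computable k (\<lambda>xs. hd xs)"
  by (rule computable_cong[OF computable_nth[of 0]]) (auto simp: hd_conv_nth)

lemma computable_nth_tl: "Suc i < k \<Longrightarrow> computable k (\<lambda>xs. tl xs ! i)"
  by (rule computable_cong[OF computable_nth[of "Suc i"]]) (auto simp: nth_tl)

lemma computable_tl:
  assumes "computable k f" shows "computable (Suc k) (\<lambda>xs. f (tl xs))"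
  using computable_args[of "[]" "Suc k" 1 f] assms by (simp add: drop_Suc)

text \<open>\<open>PrimRec\<close> puts the counter and the previous value in front of the
  parameters; hence the step function is assumed computable in the form that reads these from
  positions 0 and 1 and the parameters from the double tail.\<close>

lemma computable_rec_nat:
  assumes "computable k b" "computable (Suc (Suc k)) (\<lambda>xs. st (xs ! 0) (xs ! 1) (tl (tl xs)))"
    "computable k n"
  shows "computable k (\<lambda>xs. rec_nat (b xs) (\<lambda>m y. st m y xs) (n xs))"
proof -
  obtain p where p: "\<And>xs y. length xs = k \<Longrightarrow> computes p xs y \<longleftrightarrow> y = b xs"
    using assms(1) unfolding computable_def by blast
  obtain q where q: "\<And>m y xs z. length xs = k \<Longrightarrow> computes q (m # y # xs) z \<longleftrightarrow> z = st m y xs"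
    using assms(2) unfolding computable_def by (metis length_Cons list.sel(3) nth_Cons_0 nth_Cons_Suc One_nat_def)
  have "computes (PrimRec p q) (m # xs) y \<longleftrightarrow> y = rec_nat (b xs) (\<lambda>m y. st m y xs) m"
    if "length xs = k" for m xs y
    using that p q
    by (induction m arbitrary: y) (auto simp: computes_PrimRec_0 computes_PrimRec_Suc)
  then have "computable (Suc k) (\<lambda>xs. rec_nat (b (tl xs)) (\<lambda>m y. st m y (tl xs)) (hd xs))"
    unfolding computable_def by (intro exI[of _ "PrimRec p q"]) (auto simp: length_Suc_conv)
  from computable_args[of "[n]" k 0, simplified, OF this assms(3)] show ?thesis by simp
qed

lemma computable_add:
  assumes "computable k f" "computable k g"
  shows "computable k (\<lambda>xs. f xs + g xs)"
proof -
  have "computable k (\<lambda>xs. rec_nat (f xs) (\<lambda>m y. Suc y) (g xs))"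
    by (intro computable_rec_nat computable_Suc computable_nth assms) simp
  moreover have "rec_nat a (\<lambda>m y. Suc y) b = a + b" for a b :: nat by (induction b) auto
  ultimately show ?thesis by simp
qed

text \<open>The workhorse for bounded operations: products, bounded quantifiers, bounded search in
  \<open>ev\<close>, the length of a coded string and the decoding of pairs are all written as such
  sums. The bound variable becomes the head of the argument list.\<close>

lemma computable_sum:
  assumes "computable (Suc k) (\<lambda>xs. f (hd xs) (tl xs))" "computable k n"
  shows "computable k (\<lambda>xs. \<Sum>i<n xs. f i xs)"
proof -
  have "computable (Suc (Suc k)) (\<lambda>xs. f (xs ! 0) (tl (tl xs)))"
    using computable_args[of "[\<lambda>xs. xs ! 0]" "Suc (Suc k)" 2, simplified, OF assms(1)]
    by (simp add: computable_nth drop_Suc numeral_2_eq_2)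
  then have "computable k (\<lambda>xs. rec_nat 0 (\<lambda>m y. y + f m xs) (n xs))"
    by (intro computable_rec_nat computable_add computable_nth computable_const assms) auto
  moreover have "rec_nat 0 (\<lambda>m y. y + f m xs) b = (\<Sum>i<b. f i xs)" for b xs
    by (induction b) auto
  ultimately show ?thesis by simp
qed

lemma computable_mult:
  assumes "computable k f" "computable k g"
  shows "computable k (\<lambda>xs. f xs * g xs)"
proof -
  have "computable k (\<lambda>xs. \<Sum>i<f xs. g xs)"
    by (intro computable_sum computable_tl assms)
  then show ?thesis by simp
qed

lemma computable_power:
  assumes "computable k f" "computable k g"
  shows "computable k (\<lambda>xs. f xs ^ g xs)"
proof -
  have "computable k (\<lambda>xs. rec_nat 1 (\<lambda>m y. f xs * y) (g xs))"
    by (intro computable_rec_nat computable_mult computable_nth computable_const computable_tl assms) simp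
  moreover have "rec_nat 1 (\<lambda>m y. a * y) b = a ^ b" for a b :: nat by (induction b) auto
  ultimately show ?thesis by simp
qed

lemma computable_diff:
  assumes "computable k f" "computable k g"
  shows "computable k (\<lambda>xs. f xs - g xs)"
proof -
  have "computable 1 (\<lambda>xs. rec_nat 0 (\<lambda>m y. m) (hd xs))"
    by (intro computable_rec_nat computable_nth computable_const computable_hd) auto
  moreover have "rec_nat 0 (\<lambda>m y. m) n = n - 1" for n :: nat by (cases n) auto
  ultimately have pred: "computable 1 (\<lambda>xs. hd xs - 1)" by simp
  have "computable k (\<lambda>xs. rec_nat (f xs) (\<lambda>m y. y - 1) (g xs))"
    by (intro computable_rec_nat computable1[OF pred] computable_nth assms) simp
  moreover have "rec_nat a (\<lambda>m y. y - 1) b = a - b" for a b :: nat by (induction b) auto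
  ultimately show ?thesis by simp
qed

lemma computable_not:
  assumes "computable k (\<lambda>xs. of_bool (P xs))"
  shows "computable k (\<lambda>xs. of_bool (\<not> P xs))"
proof -
  have "computable k (\<lambda>xs. 1 - of_bool (P xs))"
    by (intro computable_diff computable_const assms)
  then show ?thesis by (rule computable_cong) simp
qed

lemma computable_conj:
  assumes "computable k (\<lambda>xs. of_bool (P xs))" "computable k (\<lambda>xs. of_bool (Q xs))"
  shows "computable k (\<lambda>xs. of_bool (P xs \<and> Q xs))"
  unfolding of_bool_conj by (intro computable_mult assms)

lemma computable_less:
  assumes "computable k f" "computable k g"
  shows "computable k (\<lambda>xs. of_bool (f xs < g xs))"
proof -
  have "computable k (\<lambda>xs. 1 - (1 - (g xs - f xs)))"
    by (intro computable_diff computable_const assms)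
  then show ?thesis by (rule computable_cong) auto
qed

lemma computable_le:
  assumes "computable k f" "computable k g"
  shows "computable k (\<lambda>xs. of_bool (f xs \<le> g xs))"
  unfolding not_less[symmetric] by (intro computable_not computable_less assms)

lemma computable_eq:
  assumes "computable k f" "computable k g"
  shows "computable k (\<lambda>xs. of_bool (f xs = g xs))"
  unfolding order_eq_iff by (intro computable_conj computable_le assms)

lemma computable_all:
  assumes "computable (Suc k) (\<lambda>xs. of_bool (P (hd xs) (tl xs)))" "computable k n"
  shows "computable k (\<lambda>xs. of_bool (\<forall>i<n xs. P i xs))"
proof -
  have "computable k (\<lambda>xs. of_bool ((\<Sum>i<n xs. of_bool (\<not> P i xs)) = (0::nat)))"
    by (intro computable_eq computable_sum computable_const computable_not assms)
  then show ?thesis by (rule computable_cong) auto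
qed

text \<open>\<open>Mu\<close> looks for a zero, so it is applied to the characteristic function of
  the negation of \<open>P\<close>. Since this function is total, the side condition of
  \<open>Mu\<close> on smaller arguments reduces to their failing \<open>P\<close>.\<close>

lemma computable_search:
  assumes "computable (Suc k) (\<lambda>xs. of_bool (P xs))" "computable (Suc k) g"
  shows "\<exists>p. \<forall>xs y. length xs = k \<longrightarrow>
    (computes p xs y \<longleftrightarrow> (\<exists>n. P (n # xs) \<and> (\<forall>m<n. \<not> P (m # xs)) \<and> y = g (n # xs)))"
proof -
  obtain p where p: "\<And>xs y. length xs = Suc k \<Longrightarrow> computes p xs y \<longleftrightarrow> y = of_bool (\<not> P xs)"
    using computable_not[OF assms(1)] unfolding computable_def by blast
  obtain q where q: "\<And>xs y. length xs = Suc k \<Longrightarrow> computes q xs y \<longleftrightarrow> y = g xs"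
    using assms(2) unfolding computable_def by blast
  \<comment> \<open>The projections pass the original arguments on to \<open>q\<close> behind the
    value found by the search.\<close>
  have "computes (Comp q (Mu p # map Proj [0..<k])) xs y \<longleftrightarrow>
      (\<exists>n. P (n # xs) \<and> (\<forall>m<n. \<not> P (m # xs)) \<and> y = g (n # xs))" if xs: "length xs = k" for xs y
  proof -
    have mu: "computes (Mu p) xs n \<longleftrightarrow> P (n # xs) \<and> (\<forall>m<n. \<not> P (m # xs))" for n
      using xs p by (auto simp: computes_Mu)
    have "list_all2 (\<lambda>g y. computes g xs y) (map Proj [0..<k]) ys \<longleftrightarrow> ys = xs" for ys
      using xs by (auto simp: list_all2_conv_all_nth list_eq_iff_nth_eq computes_Proj)
    then show ?thesis using xs mu q by (auto simp: computes_Comp list_all2_Cons1)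
  qed
  then show ?thesis by blast
qed

lemmas computable_intros = computable_const computable_nth computable_nth_tl computable_hd computable_Suc computable_add
  computable_mult computable_power computable_diff computable_not computable_conj computable_less
  computable_le computable_eq computable_all computable_sum

section \<open>A fuel-bounded evaluator for programs\<close>

text \<open>Evaluation with fuel \<open>s\<close>, which only bounds the searches of \<open>Mu\<close>. The result 0 means
  that no value was found, \<open>Suc y\<close> that the value is \<open>y\<close>.\<close>

fun ev :: "nat \<Rightarrow> recf \<Rightarrow> nat list \<Rightarrow> nat" where
  "ev s Zero xs = 1"
| "ev s Succ xs = (case xs of [x] \<Rightarrow> Suc (Suc x) | _ \<Rightarrow> 0)"
| "ev s (Proj i) xs = (if i < length xs then Suc (xs ! i) else 0)"
| "ev s (Comp f gs) xs =
     of_bool (\<forall>g\<in>set gs. 0 < ev s g xs) * ev s f (map (\<lambda>g. ev s g xs - 1) gs)"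
| "ev s (PrimRec f g) xs = (case xs of [] \<Rightarrow> 0
     | n # xs \<Rightarrow> rec_nat (ev s f xs) (\<lambda>m y. of_bool (0 < y) * ev s g (m # (y - 1) # xs)) n)"
| "ev s (Mu f) xs =
     (\<Sum>n<s. of_bool (ev s f (n # xs) = 1 \<and> (\<forall>m<n. 1 < ev s f (m # xs))) * Suc n)"

lemma ev_sound: "ev s p xs = Suc y \<Longrightarrow> computes p xs y"
proof (induction p arbitrary: xs y)
  case (Comp f gs)
  from Comp.prems have *: "\<forall>g\<in>set gs. 0 < ev s g xs" "ev s f (map (\<lambda>g. ev s g xs - 1) gs) = Suc y"
    by (auto split: if_splits simp: of_bool_def)
  have "computes g xs (ev s g xs - 1)" if "g \<in> set gs" for g
    using Comp.IH(2)[OF that] * that by simp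
  then show ?case using Comp.IH(1)[OF *(2)]
    by (intro computes.comp) (auto simp: list_all2_conv_all_nth)
next
  case (PrimRec f g)
  then obtain n ys where xs: "xs = n # ys" by (cases xs) auto
  have "computes (PrimRec f g) (n # ys) y"
    if "rec_nat (ev s f ys) (\<lambda>m y. of_bool (0 < y) * ev s g (m # (y - 1) # ys)) n = Suc y" for n y
    using that
  proof (induction n arbitrary: y)
    case 0 then show ?case by (simp add: computes.primrec_0 PrimRec.IH(1))
  next
    case (Suc n)
    let ?r = "rec_nat (ev s f ys) (\<lambda>m y. of_bool (0 < y) * ev s g (m # (y - 1) # ys)) n"
    have "?r = Suc (?r - 1)" "ev s g (n # (?r - 1) # ys) = Suc y" using Suc.prems by (cases "0 < ?r"; simp)+
    then show ?case using Suc.IH PrimRec.IH(2) computes.primrec_Suc by blast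
  qed
  then show ?case using PrimRec.prems xs by simp
next
  case (Mu f)
  let ?P = "\<lambda>n. ev s f (n # xs) = 1 \<and> (\<forall>m<n. 1 < ev s f (m # xs))"
  \<comment> \<open>At most one \<open>n\<close> is a first zero with all earlier values positive,
    so the sum in \<open>ev\<close> that expresses the search has at most one nonzero term, namely
    \<open>Suc n\<close>.\<close>
  have un: "m = n" if "?P m" "?P n" for m n
    using that by (metis linorder_neqE_nat nat_less_le)
  obtain n where n: "n < s" "?P n"
  proof -
    have "(\<Sum>n<s. of_bool (?P n) * Suc n) \<noteq> 0" using Mu.prems by simp
    then obtain n where "n \<in> {..<s}" "of_bool (?P n) * Suc n \<noteq> 0"
      using sum.not_neutral_contains_not_neutral by blast
    then show thesis by (intro that[of n]) auto
  qed
  then have "of_bool (?P m) * Suc m = (if m = n then Suc n else 0)" for m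
  proof (cases "m = n")
    case False
    then have "\<not> ?P m" using un n(2) by blast
    then show ?thesis using False by (simp only: of_bool_eq mult_zero_left if_False)
  qed (use n(2) in simp)
  then have "ev s (Mu f) xs = Suc n" using n(1) by (simp add: sum.delta)
  then have "y = n" using Mu.prems by simp
  moreover have "\<exists>y>0. computes f (m # xs) y" if "m < n" for m
    using n(2) that Mu.IH[of "m # xs" "ev s f (m # xs) - 1"] by (intro exI[of _ "ev s f (m # xs) - 1"]) auto
  ultimately show ?case using n(2) Mu.IH computes.mu by simp
qed (auto simp: computes_Zero computes_Succ computes_Proj split: list.splits if_splits)

text \<open>Claiming the value for all large fuels, not just for one, lets the finitely many
  subcomputations of a composition or a search share a common fuel: finitely many eventual
  conditions hold together eventually.\<close>

lemma ev_complete: "computes p xs y \<Longrightarrow> eventually (\<lambda>s. ev s p xs = Suc y) sequentially"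
proof (induction rule: computes.induct)
  case (comp xs gs ys f z)
  have "\<forall>i\<in>{..<length gs}. eventually (\<lambda>s. ev s (gs ! i) xs = Suc (ys ! i)) sequentially"
    using comp.IH(1) by (auto simp: list_all2_conv_all_nth)
  then have "eventually (\<lambda>s. \<forall>i\<in>{..<length gs}. ev s (gs ! i) xs = Suc (ys ! i)) sequentially"
    by (simp add: eventually_ball_finite_distrib)
  with comp.IH(2) show ?case
  proof eventually_elim
    case (elim s)
    have "length gs = length ys" using comp.IH(1) list_all2_lengthD by blast
    then have "map (\<lambda>g. ev s g xs - 1) gs = ys" using elim by (auto intro!: nth_equalityI)
    moreover have "\<forall>g\<in>set gs. 0 < ev s g xs" using elim by (auto simp: in_set_conv_nth)
    ultimately show ?case using elim by simp
  qed
next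
  case (primrec_Suc f g n xs y z)
  from primrec_Suc.IH show ?case by eventually_elim simp
next
  case (mu f n xs)
  have "\<forall>m\<in>{..<n}. eventually (\<lambda>s. 1 < ev s f (m # xs)) sequentially"
  proof
    fix m assume "m \<in> {..<n}"
    then obtain y where "y > 0" "eventually (\<lambda>s. ev s f (m # xs) = Suc y) sequentially"
      using mu.IH by blast
    then show "eventually (\<lambda>s. 1 < ev s f (m # xs)) sequentially"
      by (auto elim!: eventually_mono)
  qed
  then have "eventually (\<lambda>s. \<forall>m\<in>{..<n}. 1 < ev s f (m # xs)) sequentially"
    by (simp add: eventually_ball_finite_distrib)
  moreover have "eventually (\<lambda>s. ev s f (n # xs) = Suc 0) sequentially" using mu.IH by blast
  \<comment> \<open>The search in \<open>ev\<close> only inspects values below the fuel, so the fuel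
    must also exceed the result \<open>n\<close>.\<close>
  ultimately show ?case using eventually_gt_at_top[of n]
  proof eventually_elim
    case (elim s)
    have ne: "ev s f (k # xs) \<noteq> Suc 0" if "k < n" for k
      using bspec[OF elim(1), of k] that by simp
    have "of_bool (ev s f (k # xs) = 1 \<and> (\<forall>m<k. 1 < ev s f (m # xs))) * Suc k
        = (if k = n then Suc n else 0)" for k
      using elim ne by (cases k n rule: linorder_cases) (auto simp: of_bool_def)
    then show ?case using elim(3) by (simp add: sum.delta)
  qed
qed simp_all

text \<open>The program is fixed and only fuel and arguments vary, so structural induction on the
  program suffices. The arity is generalised because subprograms run on lists of other
  lengths.\<close>

lemma computable_ev: "computable (Suc k) (\<lambda>xs. ev (hd xs) p (tl xs))"
proof (induction p arbitrary: k)
  case Zero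
  show ?case by (simp add: computable_const)
next
  case Succ
  show ?case
  proof (cases "k = 1")
    case True
    have "computable (Suc k) (\<lambda>xs. Suc (Suc (tl xs ! 0)))"
      using True by (intro computable_intros) simp
    then show ?thesis by (rule computable_cong) (use True in \<open>auto simp: length_Suc_conv\<close>)
  next
    case False
    show ?thesis by (rule computable_cong[OF computable_const[of _ 0]])
      (use False in \<open>auto simp: length_Suc_conv split: list.splits\<close>)
  qed
next
  case (Proj i)
  show ?case
  proof (cases "i < k")
    case True
    then have "computable (Suc k) (\<lambda>xs. Suc (tl xs ! i))"
      by (intro computable_intros) simp
    then show ?thesis by (rule computable_cong) (use True in auto)
  next
    case False
    show ?thesis by (rule computable_cong[OF computable_const[of _ 0]]) (use False in auto)
  qed
next
  case (Comp f gs)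
  have all: "computable (Suc k) (\<lambda>xs. of_bool (\<forall>g\<in>set gs. 0 < ev (hd xs) g (tl xs)))"
    using Comp.IH(2)
  proof (induction gs)
    case (Cons g gs)
    have "computable (Suc k) (\<lambda>xs. of_bool (0 < ev (hd xs) g (tl xs) \<and> (\<forall>g\<in>set gs. 0 < ev (hd xs) g (tl xs))))"
      using Cons by (intro computable_intros) auto
    then show ?case by simp
  qed (simp add: computable_const)
  have "computable (Suc k) (\<lambda>xs. ev (hd xs) f (map (\<lambda>g. ev (hd xs) g (tl xs) - 1) gs))"
  proof -
    let ?hs = "hd # map (\<lambda>g xs. ev (hd xs) g (tl xs) - 1) gs"
    have "\<forall>h\<in>set ?hs. computable (Suc k) h"
      using Comp.IH(2) by (auto intro!: computable_hd computable_diff[OF _ computable_const])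
    then show ?thesis
      using computable_compose[of ?hs "\<lambda>xs. ev (hd xs) f (tl xs)"] Comp.IH(1)
      by (simp add: comp_def)
  qed
  then show ?case using all by (auto intro: computable_mult)
next
  case (PrimRec f g)
  show ?case
  proof (cases k)
    case 0
    show ?thesis by (rule computable_cong[OF computable_const[of _ 0]])
      (use 0 in \<open>auto simp: length_Suc_conv\<close>)
  next
    case (Suc j)
    have b: "computable (Suc k) (\<lambda>xs. ev (hd xs) f (tl (tl xs)))"
      using computable_args[of "[hd]" "Suc k" 2 "\<lambda>xs. ev (hd xs) f (tl xs)"] PrimRec.IH(1)[of j] Suc
      by (simp add: numeral_2_eq_2 drop_Suc computable_hd)
    \<comment> \<open>The list here is counter, previous value, fuel, recursion argument,
      parameters. The subprogram \<open>g\<close> needs fuel, counter, previous value stripped of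
      its success marker, and parameters; dropping 4 entries skips the recursion argument.\<close>
    let ?fs = "[\<lambda>xs. xs ! 2, \<lambda>xs. xs ! 0, \<lambda>xs. xs ! 1 - 1]"
    have "computable (Suc (Suc (Suc k))) (\<lambda>xs. ev (hd (map (\<lambda>h. h xs) ?fs @ drop 4 xs)) g (tl (map (\<lambda>h. h xs) ?fs @ drop 4 xs)))"
      by (rule computable_args)
        (use PrimRec.IH(2)[of "Suc (Suc j)"] Suc in \<open>auto simp: numeral_eq_Suc intro!: computable_intros\<close>)
    then have st: "computable (Suc (Suc (Suc k)))
        (\<lambda>xs. ev (hd (tl (tl xs))) g (xs ! 0 # (xs ! 1 - 1) # tl (tl (tl (tl xs)))))"
      by (rule computable_cong) (auto simp: length_Suc_conv Suc numeral_eq_Suc)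
    have "computable (Suc k) (\<lambda>xs. rec_nat (ev (hd xs) f (tl (tl xs)))
      (\<lambda>m y. of_bool (0 < y) * ev (hd xs) g (m # (y - 1) # tl (tl xs))) (tl xs ! 0))"
      by (intro computable_rec_nat b computable_mult st computable_intros) (auto simp: Suc)
    then show ?thesis by (rule computable_cong) (auto simp: length_Suc_conv Suc)
  qed
next
  case (Mu f)
  \<comment> \<open>\<open>A\<close> evaluates \<open>f\<close> below one bound variable (the
    candidate \<open>n\<close> of the search), \<open>B\<close> below two (the smaller
    \<open>m\<close> in front of \<open>n\<close>), so the fuel sits one and two places down the
    list.\<close>
  have A: "computable (Suc (Suc k)) (\<lambda>xs. ev (hd (tl xs)) f (hd xs # tl (tl xs)))"
    using computable_args[of "[\<lambda>xs. xs ! 1, hd]" "Suc (Suc k)" 2 "\<lambda>xs. ev (hd xs) f (tl xs)"] Mu.IH[of "Suc k"]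
    by (simp add: computable_nth computable_hd) (erule computable_cong, auto simp: length_Suc_conv)
  have B: "computable (Suc (Suc (Suc k))) (\<lambda>xs. ev (hd (tl (tl xs))) f (hd xs # tl (tl (tl xs))))"
    using computable_args[of "[hd]" "Suc (Suc (Suc k))" 2, simplified, OF A computable_hd, simplified]
    by (simp add: numeral_2_eq_2 drop_Suc)
  have "computable (Suc k) (\<lambda>xs. \<Sum>n<hd xs. of_bool (ev (hd xs) f (n # tl xs) = 1 \<and> (\<forall>m<n. 1 < ev (hd xs) f (m # tl xs))) * Suc n)"
    by (intro computable_intros A B) auto
  then show ?case by simp
qed

section \<open>Computable coding of strings and pairs\<close>

lemma str_code_Nil: "str_code [] = 0"
  by (simp add: str_code_def)

lemma str_code_snoc: "str_code (\<sigma> @ [b]) = 2 * str_code \<sigma> + (if b then 2 else 1)"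
  by (simp add: str_code_def)

lemma str_code_bounds: "2 ^ length \<sigma> \<le> Suc (str_code \<sigma>)" "Suc (str_code \<sigma>) < 2 ^ Suc (length \<sigma>)"
  by (induction \<sigma> rule: rev_induct) (auto simp: str_code_Nil str_code_snoc)

lemma bij_str_code: "bij str_code"
proof (rule bijI)
  show "inj str_code"
  proof (rule injI)
    show "\<sigma> = \<tau>" if "str_code \<sigma> = str_code \<tau>" for \<sigma> \<tau>
      using that
    proof (induction \<sigma> arbitrary: \<tau> rule: rev_induct)
      case Nil
      then show ?case by (cases \<tau> rule: rev_cases) (auto simp: str_code_Nil str_code_snoc split: if_splits)
    next
      case (snoc b \<sigma>)
      then obtain \<tau>' b' where \<tau>: "\<tau> = \<tau>' @ [b']"
        by (cases \<tau> rule: rev_cases) (auto simp: str_code_Nil str_code_snoc split: if_splits)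
      with snoc.prems have "str_code \<sigma> = str_code \<tau>' \<and> b = b'"
        by (auto simp: str_code_snoc split: if_splits) presburger+
      then show ?case using snoc.IH \<tau> by blast
    qed
  qed
  have "\<exists>\<sigma>. str_code \<sigma> = n" for n
  proof (induction n rule: less_induct)
    case (less n)
    show ?case
    proof (cases n)
      case 0 then show ?thesis using str_code_Nil by blast
    next
      case (Suc m)
      then have "m div 2 < n" by (simp add: less_Suc_eq_le)
      then obtain \<sigma> where "str_code \<sigma> = m div 2" using less.IH by blast
      \<comment> \<open>Codes of the two extensions of a string with code \<open>k\<close> are
        \<open>2 * k + 1\<close> and \<open>2 * k + 2\<close>, so the parity of the predecessor
        \<open>m\<close> is the last bit.\<close>
      then have "str_code (\<sigma> @ [odd m]) = n" using Suc by (auto simp: str_code_snoc; presburger)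
      then show ?thesis by blast
    qed
  qed
  then show "surj str_code" by (metis surjI)
qed

lemma str_code_inv [simp]: "str_code (inv str_code n) = n"
  by (rule surj_f_inv_f[OF bij_is_surj[OF bij_str_code]])

lemma inv_str_code [simp]: "inv str_code (str_code \<sigma>) = \<sigma>"
  by (rule inv_f_f[OF bij_is_inj[OF bij_str_code]])

text \<open>This is the binary logarithm of \<open>Suc x\<close> rounded down, obtained by counting
  exponents so that \<open>computable_sum\<close> applies. On codes of strings it is the
  length.\<close>

definition len :: "nat \<Rightarrow> nat" where
  "len x = (\<Sum>j<x. of_bool (2 ^ Suc j \<le> Suc x))"

lemma len_le: "len x \<le> x"
  unfolding len_def using sum_bounded_above[of "{..<x}" "\<lambda>j. of_bool (2 ^ Suc j \<le> Suc x)" "1::nat"] by auto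

lemma len_eqI:
  assumes "2 ^ l \<le> Suc x" "Suc x < 2 ^ Suc l"
  shows "len x = l"
proof -
  have "2 ^ Suc j \<le> Suc x \<longleftrightarrow> j < l" for j
  proof
    assume "2 ^ Suc j \<le> Suc x"
    then have "(2::nat) ^ Suc j < 2 ^ Suc l" using assms(2) by linarith
    then show "j < l" by (simp del: power_Suc)
  next
    assume "j < l"
    then have "(2::nat) ^ Suc j \<le> 2 ^ l" by (intro power_increasing) auto
    then show "2 ^ Suc j \<le> Suc x" using assms(1) by linarith
  qed
  moreover have "l < Suc x" using assms(1) less_exp[of l] by linarith
  then have "{..<x} \<inter> {j. j < l} = {..<l}" by auto
  ultimately show ?thesis unfolding len_def by (simp add: of_bool_def sum.If_cases)
qed

lemma len_str_code [simp]: "len (str_code \<sigma>) = length \<sigma>"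
  by (rule len_eqI[OF str_code_bounds])

lemma computable_len: "computable k f \<Longrightarrow> computable k (\<lambda>xs. len (f xs))"
  proof (rule computable1[where f = len])
  show "computable 1 (\<lambda>xs. len (hd xs))" unfolding len_def
    by (intro computable_intros computable_tl[OF computable_hd, unfolded One_nat_def]) simp_all
qed

lemma computable_prod_encode:
  assumes "computable k f" "computable k g"
  shows "computable k (\<lambda>xs. prod_encode (f xs, g xs))"
proof -
  \<comment> \<open>Writing the triangular number as a sum avoids the division in its closed
    form.\<close>
  have "prod_encode (a, b) = (\<Sum>i<Suc (a + b). i) + a" for a b
    using gauss_sum_nat[of "a + b"]
    by (simp add: prod_encode_def triangle_def lessThan_Suc_atMost atLeast0AtMost)
  then show ?thesis by (simp only:) (intro computable_intros computable_tl assms; simp)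
qed

text \<open>A pair code bounds both components, so a bounded double sum finds the unique pair:
  exactly one term has a true condition.\<close>

lemma prod_decode_conv_sum:
  "fst (prod_decode i) = (\<Sum>a<Suc i. \<Sum>b<Suc i. a * of_bool (prod_encode (a, b) = i))"
  "snd (prod_decode i) = (\<Sum>a<Suc i. \<Sum>b<Suc i. b * of_bool (prod_encode (a, b) = i))"
proof -
  obtain x y where xy: "prod_decode i = (x, y)" by fastforce
  then have i: "i = prod_encode (x, y)" by (metis prod_decode_inverse)
  then have le: "x < Suc i" "y < Suc i"
    using le_prod_encode_1[of x y] le_prod_encode_2[of y x] by auto
  have *: "of_bool (prod_encode (a, b) = i) = (if b = y then if a = x then 1 else 0 else (0::nat))" for a b
    using i by auto
  show "fst (prod_decode i) = (\<Sum>a<Suc i. \<Sum>b<Suc i. a * of_bool (prod_encode (a, b) = i))"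
    "snd (prod_decode i) = (\<Sum>a<Suc i. \<Sum>b<Suc i. b * of_bool (prod_encode (a, b) = i))"
    unfolding * using le xy
    by (simp_all add: if_distrib[of "\<lambda>z. _ * z"] sum.delta del: sum.lessThan_Suc cong: if_cong)
qed

lemma computable_prod_decode:
  assumes "computable k f"
  shows "computable k (\<lambda>xs. fst (prod_decode (f xs)))" "computable k (\<lambda>xs. snd (prod_decode (f xs)))"
  unfolding prod_decode_conv_sum
  by (intro computable_intros computable_prod_encode computable_tl assms; simp)+

section \<open>Dyadic intervals and Kraft's inequality\<close>

lemma Suc_str_code_snoc: "Suc (str_code (\<sigma> @ [b])) = 2 * Suc (str_code \<sigma>) + of_bool b"
  by (simp add: str_code_snoc)

text \<open>In binary notation \<open>lb \<sigma>\<close> is \<open>1.\<sigma>\<close>, so \<open>\<sigma>\<close> stands for the dyadic interval of length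
  \<open>1 / 2 ^ length \<sigma>\<close> starting at \<open>lb \<sigma> - 1\<close>.\<close>

definition lb :: "str \<Rightarrow> real" where
  "lb \<sigma> = Suc (str_code \<sigma>) / 2 ^ length \<sigma>"

text \<open>Each appended bit passes to the left or the right half of the current interval, so the
  interval of an extension is contained in that of the prefix.\<close>

lemma lb_prefix:
  assumes "prefix \<sigma> \<tau>"
  shows "lb \<sigma> \<le> lb \<tau>" "lb \<tau> + 1 / 2 ^ length \<tau> \<le> lb \<sigma> + 1 / 2 ^ length \<sigma>"
proof -
  obtain \<upsilon> where \<tau>: "\<tau> = \<sigma> @ \<upsilon>" using assms by (auto simp: prefix_def)
  have "lb \<sigma> \<le> lb (\<sigma> @ \<upsilon>) \<and> lb (\<sigma> @ \<upsilon>) + 1 / 2 ^ length (\<sigma> @ \<upsilon>) \<le> lb \<sigma> + 1 / 2 ^ length \<sigma>"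
  proof (induction \<upsilon> rule: rev_induct)
    case (snoc b \<upsilon>)
    define w where "w = 1 / (2::real) ^ length (\<sigma> @ \<upsilon> @ [b])"
    have "lb (\<sigma> @ \<upsilon> @ [b]) = lb (\<sigma> @ \<upsilon>) + of_bool b * w"
      unfolding lb_def w_def append_assoc[symmetric] Suc_str_code_snoc
      by (simp add: field_simps)
    moreover have "1 / 2 ^ length (\<sigma> @ \<upsilon>) = 2 * w" "0 < w" by (simp_all add: w_def)
    ultimately show ?case using snoc unfolding w_def[symmetric] by (cases b) auto
  qed simp
  then show "lb \<sigma> \<le> lb \<tau>" "lb \<tau> + 1 / 2 ^ length \<tau> \<le> lb \<sigma> + 1 / 2 ^ length \<sigma>"
    using \<tau> by auto
qed

lemma prefix_free_mono: "prefix_free B \<Longrightarrow> A \<subseteq> B \<Longrightarrow> prefix_free A"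
  unfolding prefix_free_def by blast

text \<open>Extend every word in all possible ways to the maximal length \<open>n\<close>.
  Prefix-freeness makes these sets of extensions disjoint, and together they have at most
  \<open>2 ^ n\<close> elements.\<close>

lemma kraft_inequality:
  assumes "finite A" "prefix_free A"
  shows "(\<Sum>\<sigma>\<in>A. 1 / 2 ^ length \<sigma>) \<le> (1::real)"
proof -
  define n where "n = Max (insert 0 (length ` A))"
  have n: "length \<sigma> \<le> n" if "\<sigma> \<in> A" for \<sigma>
    unfolding n_def using assms(1) that by (intro Max_ge) auto
  define E where "E \<sigma> = (@) \<sigma> ` {\<tau>::str. length \<tau> = n - length \<sigma>}" for \<sigma>
  have card_lists: "card {\<tau>::str. length \<tau> = m} = 2 ^ m" and fin: "finite {\<tau>::str. length \<tau> = m}" for m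
    using card_lists_length_eq[of "UNIV :: bool set" m] finite_lists_length_eq[of "UNIV :: bool set" m] by auto
  have card_E: "card (E \<sigma>) = 2 ^ (n - length \<sigma>)" for \<sigma>
    unfolding E_def using card_lists by (subst card_image) (auto simp: inj_on_def)
  have "E \<sigma> \<inter> E \<tau> = {}" if "\<sigma> \<in> A" "\<tau> \<in> A" "\<sigma> \<noteq> \<tau>" for \<sigma> \<tau>
  proof (rule ccontr)
    assume "E \<sigma> \<inter> E \<tau> \<noteq> {}"
    then obtain \<upsilon> where "prefix \<sigma> \<upsilon>" "prefix \<tau> \<upsilon>" by (auto simp: E_def prefix_def)
    then show False using prefix_same_cases that assms(2) unfolding prefix_free_def by blast
  qed
  then have "card (\<Union>\<sigma>\<in>A. E \<sigma>) = (\<Sum>\<sigma>\<in>A. 2 ^ (n - length \<sigma>))"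
    unfolding card_E[symmetric] using assms(1) fin by (intro card_UN_disjoint) (auto simp: E_def)
  moreover have "card (\<Union>\<sigma>\<in>A. E \<sigma>) \<le> card {\<tau>::str. length \<tau> = n}"
    using n fin by (intro card_mono) (auto simp: E_def)
  ultimately have "(\<Sum>\<sigma>\<in>A. 2 ^ (n - length \<sigma>)) \<le> (2::nat) ^ n"
    using card_lists by simp
  then have "real (\<Sum>\<sigma>\<in>A. 2 ^ (n - length \<sigma>)) \<le> 2 ^ n"
    by (metis of_nat_le_iff of_nat_numeral of_nat_power)
  moreover have "(\<Sum>\<sigma>\<in>A. 1 / 2 ^ length \<sigma>) = real (\<Sum>\<sigma>\<in>A. 2 ^ (n - length \<sigma>)) / 2 ^ n"
  proof -
    have "real (2 ^ (n - length \<sigma>)) / 2 ^ n = 1 / 2 ^ length \<sigma>" if "\<sigma> \<in> A" for \<sigma>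
      unfolding of_nat_power of_nat_numeral using n[OF that] by (simp add: power_diff)
    then show ?thesis unfolding of_nat_sum sum_divide_distrib by simp
  qed
  ultimately show ?thesis by simp
qed

section \<open>Halting computations and their Kraft weights\<close>

text \<open>The index \<open>i\<close> codes a program and an amount of fuel; asking for the least sufficient fuel makes
  each program of the domain occur at a single index.\<close>

definition halting :: "recf \<Rightarrow> nat \<Rightarrow> bool" where
  "halting p i \<longleftrightarrow> 0 < ev (snd (prod_decode i)) p [fst (prod_decode i)] \<and>
     (\<forall>t<snd (prod_decode i). ev t p [fst (prod_decode i)] = 0)"

definition weight :: "recf \<Rightarrow> nat \<Rightarrow> real" where
  "weight p i = of_bool (halting p i) / 2 ^ len (fst (prod_decode i))"

lemma weight_nonneg: "0 \<le> weight p i"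
  by (simp add: weight_def)

lemma halting_unique:
  assumes "halting p i" "halting p j" "fst (prod_decode i) = fst (prod_decode j)"
  shows "i = j"
proof -
  have "snd (prod_decode i) = snd (prod_decode j)"
    using assms unfolding halting_def by (metis linorder_neqE_nat less_numeral_extra(3))
  then show ?thesis using assms(3) by (metis prod.expand prod_decode_inverse)
qed

text \<open>The left endpoint of the interval of computation \<open>i\<close>, multiplied by
  \<open>2 ^ i\<close> to stay within the natural numbers. The truncated subtraction is exact,
  because an index \<open>j < i\<close> codes a program of length at most \<open>j\<close>.\<close>

definition scaled_sum :: "recf \<Rightarrow> nat \<Rightarrow> nat \<Rightarrow> nat" where
  "scaled_sum p N i = (\<Sum>j<i. of_bool (N \<le> j \<and> halting p j) * 2 ^ (i - len (fst (prod_decode j))))"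

lemma scaled_sum: "real (scaled_sum p N i) = 2 ^ i * (\<Sum>j=N..<i. weight p j)"
proof -
  have "len (fst (prod_decode j)) \<le> i" if "j < i" for j
    using that len_le[of "fst (prod_decode j)"] le_prod_encode_1[of "fst (prod_decode j)" "snd (prod_decode j)"]
    by simp
  then have "real (2 ^ (i - len (fst (prod_decode j)))) = 2 ^ i / 2 ^ len (fst (prod_decode j))" if "j < i" for j
    unfolding of_nat_power of_nat_numeral using that by (simp add: power_diff)
  then have "real (scaled_sum p N i) = (\<Sum>j<i. of_bool (N \<le> j) * (2 ^ i * weight p j))"
    unfolding scaled_sum_def weight_def of_nat_sum
    by (intro sum.cong) (auto simp del: of_nat_power)
  also have "\<dots> = (\<Sum>j=N..<i. 2 ^ i * weight p j)"
    by (intro sum.mono_neutral_cong_right) auto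
  finally show ?thesis by (simp add: sum_distrib_left)
qed

section \<open>Codewords from packed dyadic intervals\<close>

text \<open>The conditions of \<open>codeword_iff\<close> below, cleared of denominators and hence visibly computable:
  the interval of \<open>\<sigma>\<close>, scaled down by \<open>2 ^ c\<close>, is the first dyadic one of half the length
  inside the interval of the \<open>i\<close>-th computation.\<close>

definition codeword :: "recf \<Rightarrow> nat \<Rightarrow> nat \<Rightarrow> nat \<Rightarrow> nat \<Rightarrow> bool" where
  "codeword p c N i z \<longleftrightarrow> N \<le> i \<and> halting p i \<and> len (fst (prod_decode i)) + 1 = len z + c \<and>
     scaled_sum p N i * 2 ^ (len z + c) \<le> (Suc z - 2 ^ len z) * 2 ^ i \<and>
     (Suc z - 2 ^ len z) * 2 ^ i < scaled_sum p N i * 2 ^ (len z + c) + 2 ^ i"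

lemma codeword_iff:
  "codeword p c N i (str_code \<sigma>) \<longleftrightarrow>
     N \<le> i \<and> halting p i \<and> len (fst (prod_decode i)) + 1 = length \<sigma> + c \<and>
     2 ^ c * (\<Sum>j=N..<i. weight p j) \<le> lb \<sigma> - 1 \<and>
     lb \<sigma> - 1 < 2 ^ c * (\<Sum>j=N..<i. weight p j) + 1 / 2 ^ length \<sigma>"
proof -
  \<comment> \<open>\<open>?m\<close> is the position of \<sigma> among the strings of its length,
    that is, the numerator of \<open>lb \<sigma> - 1\<close>. Both inequalities are then multiplied
    by \<open>2 ^ i * 2 ^ length \<sigma>\<close>.\<close>
  let ?S = "\<Sum>j=N..<i. weight p j" and ?l = "length \<sigma>" and ?m = "Suc (str_code \<sigma>) - 2 ^ length \<sigma>"
  have m: "real ?m = (lb \<sigma> - 1) * 2 ^ ?l"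
    using str_code_bounds(1)[of \<sigma>] by (simp add: lb_def of_nat_diff field_simps)
  have "scaled_sum p N i * 2 ^ (?l + c) \<le> ?m * 2 ^ i \<longleftrightarrow>
      real (scaled_sum p N i * 2 ^ (?l + c)) \<le> real (?m * 2 ^ i)" by (rule of_nat_le_iff[symmetric])
  also have "\<dots> \<longleftrightarrow> (2 ^ c * ?S) * (2 ^ i * 2 ^ ?l) \<le> (lb \<sigma> - 1) * (2 ^ i * 2 ^ ?l)"
    unfolding of_nat_mult scaled_sum m by (simp add: power_add mult_ac del: mult_le_cancel_right mult_le_cancel_left)
  also have "\<dots> \<longleftrightarrow> 2 ^ c * ?S \<le> lb \<sigma> - 1" by (intro mult_le_cancel_right_pos) simp
  finally have 1: "scaled_sum p N i * 2 ^ (?l + c) \<le> ?m * 2 ^ i \<longleftrightarrow> 2 ^ c * ?S \<le> lb \<sigma> - 1" .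
  have "?m * 2 ^ i < scaled_sum p N i * 2 ^ (?l + c) + 2 ^ i \<longleftrightarrow>
      real (?m * 2 ^ i) < real (scaled_sum p N i * 2 ^ (?l + c) + 2 ^ i)" by (rule of_nat_less_iff[symmetric])
  also have "\<dots> \<longleftrightarrow> (lb \<sigma> - 1) * (2 ^ i * 2 ^ ?l) < (2 ^ c * ?S + 1 / 2 ^ ?l) * (2 ^ i * 2 ^ ?l)"
    unfolding of_nat_mult of_nat_add scaled_sum m distrib_right by (simp add: power_add mult_ac)
  also have "\<dots> \<longleftrightarrow> lb \<sigma> - 1 < 2 ^ c * ?S + 1 / 2 ^ ?l" by (intro mult_less_cancel_right_pos) simp
  finally have 2: "?m * 2 ^ i < scaled_sum p N i * 2 ^ (?l + c) + 2 ^ i \<longleftrightarrow> lb \<sigma> - 1 < 2 ^ c * ?S + 1 / 2 ^ ?l" .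
  show ?thesis unfolding codeword_def len_str_code 1 2 ..
qed

text \<open>Codeword intervals of different computations lie in disjoint intervals, whereas a prefix
  would force them to be nested. Equal indices give equal lengths, hence equal strings. Taken with
  equal strings, the lemma says that a codeword determines its index.\<close>

lemma codeword_unique:
  assumes "codeword p c N i (str_code \<sigma>)" "codeword p c N j (str_code \<tau>)" "prefix \<sigma> \<tau>"
  shows "i = j \<and> \<sigma> = \<tau>"
proof -
  let ?S = "\<lambda>i. \<Sum>j=N..<i. weight p j"
  \<comment> \<open>Scaled by \<open>2 ^ c\<close>, the interval of computation \<open>i\<close> is
    twice as long as that of its codeword, and it ends before the scaled interval of any later
    \<open>j\<close> starts.\<close>
  have step: "2 ^ c * ?S i + 2 / 2 ^ length \<sigma> \<le> 2 ^ c * ?S j" if "codeword p c N i (str_code \<sigma>)" "i < j" for i j \<sigma>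
  proof -
    have i: "N \<le> i" "halting p i" and l: "len (fst (prod_decode i)) + 1 = length \<sigma> + c"
      using that by (auto simp: codeword_iff)
    have "?S (Suc i) \<le> ?S j" using that by (intro sum_mono2) (auto simp: weight_nonneg)
    then have "?S i + weight p i \<le> ?S j" using i by simp
    moreover have "2 ^ c * weight p i = 2 / 2 ^ length \<sigma>"
    proof -
      have "(2::real) ^ len (fst (prod_decode i)) * 2 = 2 ^ length \<sigma> * 2 ^ c"
        using arg_cong[OF l, of "\<lambda>n. (2::real) ^ n"] by (simp add: power_add)
      then show ?thesis using i by (simp add: weight_def field_simps)
    qed
    ultimately show ?thesis by (metis distrib_left mult_le_cancel_left_pos zero_less_numeral zero_less_power)
  qed
  have pos: "0 < 1 / (2::real) ^ length \<upsilon>" for \<upsilon> :: str by simp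
  have two: "2 / (2::real) ^ length \<upsilon> = 1 / 2 ^ length \<upsilon> + 1 / 2 ^ length \<upsilon>" for \<upsilon> :: str by simp
  have "i = j"
  proof (cases i j rule: linorder_cases)
    case less
    show ?thesis
      using step[OF assms(1) less] assms(1,2) lb_prefix[OF assms(3)] pos[of \<sigma>] pos[of \<tau>] two[of \<sigma>]
      unfolding codeword_iff by linarith
  next
    case greater
    show ?thesis
      using step[OF assms(2) greater] assms(1,2) lb_prefix[OF assms(3)] pos[of \<sigma>] pos[of \<tau>] two[of \<tau>]
      unfolding codeword_iff by linarith
  qed
  moreover from this have "length \<sigma> = length \<tau>" using assms(1,2) by (auto simp: codeword_iff)
  then have "\<sigma> = \<tau>" using assms(3) by (auto simp: prefix_def)
  ultimately show ?thesis by blast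
qed

text \<open>Smallness of the tail keeps the interval of \<open>i\<close>, scaled by
  \<open>2 ^ c\<close>, inside the unit interval. Its length is two grid steps, so rounding its left
  endpoint up to the grid leaves room for one full step.\<close>

lemma codeword_exists:
  assumes small: "\<And>n. (\<Sum>j=N..<n. weight p j) < 1 / 2 ^ c" and i: "N \<le> i" "halting p i"
  obtains \<sigma> where "codeword p c N i (str_code \<sigma>)"
proof -
  let ?S = "\<Sum>j=N..<i. weight p j" and ?l = "len (fst (prod_decode i))"
  \<comment> \<open>The bound at \<open>Suc i\<close> includes the weight of \<open>i\<close>
    itself, so it controls the right endpoint. It also yields \<open>c < ?l\<close> below, which
    makes the subtraction in \<open>L\<close> exact.\<close>
  have S: "?S + 1 / 2 ^ ?l < 1 / 2 ^ c" using small[of "Suc i"] i by (simp add: weight_def)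
  have S0: "0 \<le> ?S" by (simp add: sum_nonneg weight_nonneg)
  have "1 / 2 ^ ?l < 1 / (2::real) ^ c" using S S0 by linarith
  then have "(2::real) ^ c < 2 ^ ?l" by (simp add: field_simps)
  then have c: "c < ?l" by simp
  define L where "L = Suc ?l - c"
  have L: "?l + 1 = L + c" using c by (simp add: L_def)
  have pow: "(2::real) ^ ?l * 2 = 2 ^ L * 2 ^ c"
    using arg_cong[OF L, of "\<lambda>n. (2::real) ^ n"] by (simp add: power_add)
  \<comment> \<open>\<open>X\<close> is the scaled left endpoint in units of the grid of width
    \<open>1 / 2 ^ L\<close>, and \<open>m\<close> is the first grid point from there on. The right
    endpoint is \<open>X + 2\<close>; since it is below \<open>2 ^ L\<close>, the number
    \<open>m\<close> has a notation with \<open>L\<close> bits.\<close>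
  define X where "X = 2 ^ c * ?S * 2 ^ L"
  define m where "m = nat \<lceil>X\<rceil>"
  have "0 \<le> X" using S0 by (simp add: X_def)
  then have m: "X \<le> real m" "real m < X + 1" unfolding m_def by linarith+
  have "(?S + 1 / 2 ^ ?l) * (2 ^ ?l * 2) < 1 / 2 ^ c * (2 ^ ?l * 2)"
    using S by (intro mult_strict_right_mono) auto
  moreover have "(?S + 1 / 2 ^ ?l) * (2 ^ ?l * 2) = X + 2"
  proof -
    have "?S * (2 ^ ?l * 2) = X" unfolding pow X_def by simp
    then show ?thesis unfolding distrib_right by simp
  qed
  moreover have "1 / 2 ^ c * (2 ^ ?l * 2) = (2::real) ^ L" unfolding pow by simp
  ultimately have "X + 2 < 2 ^ L" by simp
  then have "real m < real (2 ^ L)" using m unfolding of_nat_power of_nat_numeral by linarith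
  then have mL: "m < 2 ^ L" using of_nat_less_iff by blast
  define \<sigma> where "\<sigma> = inv str_code (2 ^ L - 1 + m)"
  have code: "Suc (str_code \<sigma>) = 2 ^ L + m" by (simp add: \<sigma>_def)
  have "length \<sigma> = L"
    using len_eqI[of L "str_code \<sigma>"] code mL by simp
  then have lb: "lb \<sigma> - 1 = real m / 2 ^ L"
    unfolding lb_def code by (simp add: field_simps)
  have "codeword p c N i (str_code \<sigma>)"
    unfolding codeword_iff lb \<open>length \<sigma> = L\<close> using i L m
    by (simp add: X_def field_simps)
  then show thesis using that by blast
qed

section \<open>The conditional decoding machine\<close>

lemma computable_halting:
  assumes "computable k f" shows "computable k (\<lambda>xs. of_bool (halting p (f xs)))"
proof -
  have ev: "computable k (\<lambda>xs. ev (g xs) p [h xs])" if "computable k g" "computable k h" for k g h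
    using computable_compose[OF _, of "[g, h]" "\<lambda>xs. ev (hd xs) p (tl xs)" k] computable_ev[of 1 p] that
    by simp
  show ?thesis unfolding halting_def
    by (intro computable_intros ev computable_prod_decode computable_tl assms; simp)
qed

lemma computable_output:
  assumes "computable k f" shows "computable k (\<lambda>xs. ev (snd (prod_decode (f xs))) p [fst (prod_decode (f xs))] - 1)"
  using computable_compose[OF _, of "[\<lambda>xs. snd (prod_decode (f xs)), \<lambda>xs. fst (prod_decode (f xs))]" "\<lambda>xs. ev (hd xs) p (tl xs)" k] computable_ev[of 1 p] assms
  by (simp add: computable_prod_decode computable_diff computable_const)

lemma computable_scaled_sum:
  assumes "computable k f" "computable k g"
  shows "computable k (\<lambda>xs. scaled_sum p (f xs) (g xs))"
  unfolding scaled_sum_def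
  by (intro computable_intros computable_halting computable_len computable_prod_decode computable_tl assms; simp)

lemma computable_codeword:
  assumes "computable k c" "computable k N" "computable k i" "computable k z"
  shows "computable k (\<lambda>xs. of_bool (codeword p (c xs) (N xs) (i xs) (z xs)))"
  unfolding codeword_def
  by (intro computable_intros computable_halting computable_scaled_sum computable_len computable_prod_decode assms)

text \<open>The condition codes the pair \<open>(c, N)\<close>, so a single machine serves all
  choices of both and its universality constant depends on neither. Conditions whose tail is not
  small are harmless: \<open>codeword_unique\<close> covers every pair.\<close>

definition compressor :: "recf \<Rightarrow> str \<Rightarrow> str \<Rightarrow> str option" where
  "compressor p \<rho> \<sigma> = (let cw = \<lambda>i. codeword p (fst (prod_decode (str_code \<rho>))) (snd (prod_decode (str_code \<rho>))) i (str_code \<sigma>);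
     i = LEAST i. cw i
   in if \<exists>i. cw i then Some (inv str_code (ev (snd (prod_decode i)) p [fst (prod_decode i)] - 1)) else None)"

lemma cond_pf_machine_compressor: "cond_pf_machine (compressor p)"
proof -
  \<comment> \<open>Position 0 holds the index searched for, positions 1 and 2 the codes of the
    condition and the codeword.\<close>
  let ?cw = "\<lambda>xs. codeword p (fst (prod_decode (xs ! 1))) (snd (prod_decode (xs ! 1))) (xs ! 0) (xs ! 2)"
  have "\<exists>q. \<forall>xs y. length xs = 2 \<longrightarrow> (computes q xs y \<longleftrightarrow> (\<exists>n. ?cw (n # xs) \<and> (\<forall>m<n. \<not> ?cw (m # xs)) \<and>
      y = ev (snd (prod_decode ((n # xs) ! 0))) p [fst (prod_decode ((n # xs) ! 0))] - 1))"
    by (rule computable_search; intro computable_codeword computable_output computable_prod_decode computable_nth; simp)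
  then obtain q where q: "\<And>xs y. length xs = 2 \<Longrightarrow> computes q xs y \<longleftrightarrow> (\<exists>n. ?cw (n # xs) \<and> (\<forall>m<n. \<not> ?cw (m # xs)) \<and>
      y = ev (snd (prod_decode ((n # xs) ! 0))) p [fst (prod_decode ((n # xs) ! 0))] - 1)" by blast
  have least: "(\<exists>n. P n \<and> (\<forall>m<n. \<not> P m) \<and> y = g n) \<longleftrightarrow> (\<exists>n. P n) \<and> y = g (LEAST n. P n)"
    for P and g :: "nat \<Rightarrow> nat" and y
    by (metis LeastI_ex not_less_Least nat_neq_iff)
  have "computes q [str_code \<rho>, str_code \<sigma>] y \<longleftrightarrow> (\<exists>\<tau>. compressor p \<rho> \<sigma> = Some \<tau> \<and> y = str_code \<tau>)" for \<rho> \<sigma> y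
    unfolding q[of "[str_code \<rho>, str_code \<sigma>]", simplified] least compressor_def Let_def
    by auto
  then have "partial_computable2 (compressor p)" unfolding partial_computable2_def by blast
  moreover have "prefix_free (dom (compressor p \<rho>))" for \<rho>
    unfolding prefix_free_def dom_def compressor_def Let_def
    by (auto split: if_splits dest: codeword_unique)
  ultimately show ?thesis unfolding cond_pf_machine_def by blast
qed

lemma compressor_eq:
  assumes "codeword p c N i (str_code \<sigma>)"
  shows "compressor p (inv str_code (prod_encode (c, N))) \<sigma> =
     Some (inv str_code (ev (snd (prod_decode i)) p [fst (prod_decode i)] - 1))"
proof -
  have "(LEAST i. codeword p c N i (str_code \<sigma>)) = i"
    using assms by (metis LeastI codeword_unique prefix_order.refl)
  then show ?thesis using assms by (auto simp: compressor_def Let_def)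
qed

section \<open>Range of a universal machine and summability of the weights\<close>

text \<open>Universality is applied to the machine defined at the empty string only, with value
  \<tau>. The result ensures that the minimum in \<open>K U \<tau>\<close> is attained.\<close>

lemma universal_pf_machine_range:
  assumes "universal_pf_machine U"
  obtains \<sigma> where "U \<sigma> = Some \<tau>"
proof -
  let ?M = "\<lambda>\<sigma>::str. if \<sigma> = [] then Some \<tau> else None"
  \<comment> \<open>The test ignores the search variable: the search stops at 0 if the input codes
    the empty string and diverges otherwise.\<close>
  have "\<exists>q. \<forall>xs y. length xs = 1 \<longrightarrow> (computes q xs y \<longleftrightarrow> (\<exists>n. (n # xs) ! 1 = 0 \<and>
      (\<forall>m<n. \<not> (m # xs) ! 1 = 0) \<and> y = str_code \<tau>))"
    by (rule computable_search; intro computable_intros; simp)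
  then obtain q where q: "\<And>xs y. length xs = 1 \<Longrightarrow> computes q xs y \<longleftrightarrow> (\<exists>n. (n # xs) ! 1 = 0 \<and>
      (\<forall>m<n. \<not> (m # xs) ! 1 = 0) \<and> y = str_code \<tau>)" by blast
  have "str_code \<sigma> = 0 \<longleftrightarrow> \<sigma> = []" for \<sigma> by (metis inv_str_code str_code_Nil)
  then have "computes q [str_code \<sigma>] y \<longleftrightarrow> (\<exists>\<tau>. ?M \<sigma> = Some \<tau> \<and> y = str_code \<tau>)" for \<sigma> y
    using q[of "[str_code \<sigma>]"] by auto
  then have "partial_computable ?M" unfolding partial_computable_def by blast
  then have "pf_machine ?M"
    unfolding pf_machine_def prefix_free_def by (auto split: if_splits)
  then obtain d where "\<forall>\<sigma> \<tau>'. ?M \<sigma> = Some \<tau>' \<longrightarrow> (\<exists>\<sigma>'. U \<sigma>' = Some \<tau>' \<and> length \<sigma>' \<le> length \<sigma> + d)"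
    using assms unfolding universal_pf_machine_def by blast
  from this[rule_format, of "[]" \<tau>] show thesis using that by auto
qed

text \<open>Halting indices correspond injectively to programs in the prefix-free domain of
  \<open>U\<close>, so Kraft's inequality bounds every partial sum by 1.\<close>

lemma summable_weight:
  assumes p: "\<And>\<sigma> y. computes p [str_code \<sigma>] y \<longleftrightarrow> (\<exists>\<tau>. U \<sigma> = Some \<tau> \<and> y = str_code \<tau>)"
    and "prefix_free (dom U)"
  shows "summable (weight p)"
proof (rule summableI_nonneg_bounded)
  fix n
  let ?I = "{i. i < n \<and> halting p i}" and ?\<sigma> = "\<lambda>i. inv str_code (fst (prod_decode i))"
  have inj: "inj_on ?\<sigma> ?I"
  proof (rule inj_onI)
    fix i j assume ij: "i \<in> ?I" "j \<in> ?I" "?\<sigma> i = ?\<sigma> j"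
    from ij(3) have "str_code (?\<sigma> i) = str_code (?\<sigma> j)" by (rule arg_cong)
    then have "fst (prod_decode i) = fst (prod_decode j)" by simp
    then show "i = j" using halting_unique[of p i j] ij(1,2) by blast
  qed
  have "?\<sigma> i \<in> dom U" if "halting p i" for i
  proof -
    have "0 < ev (snd (prod_decode i)) p [fst (prod_decode i)]"
      using that unfolding halting_def by (rule conjunct1)
    from ev_sound[OF Suc_pred'[OF this]]
    have "\<exists>y. computes p [str_code (?\<sigma> i)] y" unfolding str_code_inv by (rule exI)
    then show ?thesis using p[of "?\<sigma> i"] by blast
  qed
  then have "?\<sigma> ` ?I \<subseteq> dom U" by blast
  then have "prefix_free (?\<sigma> ` ?I)" by (rule prefix_free_mono[OF assms(2)])
  then have "(\<Sum>\<sigma>\<in>?\<sigma> ` ?I. 1 / 2 ^ length \<sigma>) \<le> (1::real)" by (intro kraft_inequality) auto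
  also have "(\<Sum>\<sigma>\<in>?\<sigma> ` ?I. 1 / 2 ^ length \<sigma>) = (\<Sum>i\<in>?I. weight p i)"
  proof -
    have "length (?\<sigma> i) = len (fst (prod_decode i))" for i using len_str_code[of "?\<sigma> i"] by simp
    then show ?thesis unfolding sum.reindex[OF inj] by (intro sum.cong) (auto simp: weight_def)
  qed
  also have "\<dots> = (\<Sum>i<n. weight p i)"
    by (intro sum.mono_neutral_left) (auto simp: weight_def)
  finally show "(\<Sum>i<n. weight p i) \<le> 1" .
qed (rule weight_nonneg)

section \<open>Compression of all but finitely many strings\<close>

theorem theorem6p2:
  fixes U :: "str \<Rightarrow> str option" and V :: "str \<Rightarrow> str \<Rightarrow> str option"
  assumes "universal_pf_machine U" and "universal_cond_pf_machine V"
  shows "\<forall>e::nat. \<exists>\<rho>::str. \<forall>\<^sub>\<infinity>\<tau>. int (cond_K V \<tau> \<rho>) < int (K U \<tau>) - int e"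
proof
  fix e :: nat
  obtain p where p: "\<And>\<sigma> y. computes p [str_code \<sigma>] y \<longleftrightarrow> (\<exists>\<tau>. U \<sigma> = Some \<tau> \<and> y = str_code \<tau>)"
    and pf: "prefix_free (dom U)"
    using assms(1) unfolding universal_pf_machine_def pf_machine_def partial_computable_def by blast
  obtain d where d: "\<And>\<rho> \<sigma> \<tau>. compressor p \<rho> \<sigma> = Some \<tau> \<Longrightarrow>
      \<exists>\<sigma>'. V \<rho> \<sigma>' = Some \<tau> \<and> length \<sigma>' \<le> length \<sigma> + d"
    using assms(2) cond_pf_machine_compressor unfolding universal_cond_pf_machine_def by blast
  \<comment> \<open>A codeword has length \<open>K U \<tau> + 1 - c\<close> and \<open>V\<close>
    adds at most \<open>d\<close>, giving at most \<open>K U \<tau> - e - 1\<close>. Of the summand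
    2, one unit pays for halving the interval and one for strictness.\<close>
  define c where "c = d + e + 2"
  obtain N where N: "\<And>n. (\<Sum>j=N..<n. weight p j) < 1 / 2 ^ c"
  proof -
    have "0 < 1 / (2::real) ^ c" by simp
    then obtain N where "\<forall>m\<ge>N. \<forall>n. norm (\<Sum>j=m..<n. weight p j) < 1 / 2 ^ c"
      using summable_weight[OF p pf] unfolding summable_Cauchy by blast
    then have "\<bar>\<Sum>j=N..<n. weight p j\<bar> < 1 / 2 ^ c" for n by simp
    then show thesis using that[of N] abs_less_iff by blast
  qed
  define \<rho> where "\<rho> = inv str_code (prod_encode (c, N))"
  let ?out = "\<lambda>i. inv str_code (ev (snd (prod_decode i)) p [fst (prod_decode i)] - 1)"
  \<comment> \<open>The exceptional strings are among the outputs at indices below \<open>N\<close>.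
    Indices that are not halting may contribute spurious strings, but the set stays finite.\<close>
  have "int (cond_K V \<tau> \<rho>) < int (K U \<tau>) - int e" if \<tau>: "\<tau> \<notin> ?out ` {..<N}" for \<tau>
  proof -
    have "\<exists>n \<sigma>. U \<sigma> = Some \<tau> \<and> length \<sigma> = n" using universal_pf_machine_range[OF assms(1)] by metis
    from LeastI_ex[OF this] obtain \<sigma> where \<sigma>: "U \<sigma> = Some \<tau>" "length \<sigma> = K U \<tau>"
      unfolding K_def by blast
    then have "computes p [str_code \<sigma>] (str_code \<tau>)" using p by blast
    from ev_complete[OF this] obtain s where "0 < ev s p [str_code \<sigma>]"
      unfolding eventually_sequentially by fastforce
    then have "\<exists>s. 0 < ev s p [str_code \<sigma>] \<and> (\<forall>t<s. ev t p [str_code \<sigma>] = 0)"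
      using exists_least_iff[of "\<lambda>s. 0 < ev s p [str_code \<sigma>]"] by auto
    then obtain s where s: "0 < ev s p [str_code \<sigma>]" "\<forall>t<s. ev t p [str_code \<sigma>] = 0" by blast
    \<comment> \<open>\<sigma> is a shortest program for \<tau> and \<open>s\<close> its least
      sufficient fuel, so \<open>i\<close> is the index at which this program occurs in the
      enumeration.\<close>
    define i where "i = prod_encode (str_code \<sigma>, s)"
    have i: "halting p i" "len (fst (prod_decode i)) = K U \<tau>" using s \<sigma> by (auto simp: halting_def i_def)
    have "computes p [str_code \<sigma>] (ev s p [str_code \<sigma>] - 1)" using s(1) by (intro ev_sound) auto
    then have out: "?out i = \<tau>" using p \<sigma>(1) by (auto simp: i_def)
    have "N \<le> i"
    proof (rule ccontr)
      assume "\<not> N \<le> i"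
      then have "?out i \<in> ?out ` {..<N}" by (intro imageI) simp
      then show False using \<tau> unfolding out by contradiction
    qed
    from codeword_exists[OF N this i(1)] obtain \<sigma>' where \<sigma>': "codeword p c N i (str_code \<sigma>')" .
    then have "compressor p \<rho> \<sigma>' = Some \<tau>" using compressor_eq[OF \<sigma>'] out unfolding \<rho>_def by simp
    from d[OF this] obtain \<upsilon> where \<upsilon>: "V \<rho> \<upsilon> = Some \<tau>" "length \<upsilon> \<le> length \<sigma>' + d" by blast
    then have "cond_K V \<tau> \<rho> \<le> length \<upsilon>" unfolding cond_K_def K_def by (intro Least_le) blast
    moreover have "K U \<tau> + 1 = length \<sigma>' + c" using \<sigma>' i(2) by (simp add: codeword_iff)
    ultimately show ?thesis using \<upsilon>(2) by (simp add: c_def)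
  qed
  then have "{\<tau>. \<not> int (cond_K V \<tau> \<rho>) < int (K U \<tau>) - int e} \<subseteq> ?out ` {..<N}" by blast
  then have "\<forall>\<^sub>\<infinity>\<tau>. int (cond_K V \<tau> \<rho>) < int (K U \<tau>) - int e"
    unfolding eventually_cofinite by (rule finite_subset) simp
  then show "\<exists>\<rho>. \<forall>\<^sub>\<infinity>\<tau>. int (cond_K V \<tau> \<rho>) < int (K U \<tau>) - int e" by blast
qed

end
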